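(* Let $\mathcal{H}$ be a finite-dimensional Euclidean space, $(\Omega,\mathcal{F},\mathbb{P})$ a probability space, $(\mathbf{x}_k)_{k\in\mathbb{N}}$ a stochastic process with values in $\mathcal{H}$, and $\chi_\infty$ its (random) set of accumulation points. Let $V:\mathcal{H}\to\mathbb{R}$ and $\Gamma\subset\mathcal{H}$ be such that: (1) $V$ is coercive and continuously differentiable; (2) $(V(\mathbf{x}_k))_{k\in\mathbb{N}}$ converges a.s. to a random variable $V_\infty$ with $V_\infty<+\infty$ a.s.; (3) $\Gamma$ is a deterministic non-empty subset of $\mathcal{H}$ with $|V(\Gamma)|<+\infty$, and almost surely $\Gamma\cap\chi_\infty\neq\emptyset$; (4) $V$ satisfies the Kurdyka-Lojasiewicz (KL) property on $\mathcal{H}$, and there is a positive integer $I<+\infty$ such that $\Gamma=\bigcup_{i=1}^I C_i$, where each $C_i$ is a compact set on which $V$ is constant. Assume moreover that the event $$\Pi_V:=\liminf_{k\to+\infty}\{\omega\in\Omega\mid V(\mathbf{x}_k(\omega))>V_\infty(\omega)\}$$ satisfies $\mathbb{P}(\Pi_V)=1$. Then there exist a bounded function $\varphi\in\Phi_{+\infty}$ and an a.s. finite positive discrete random variable $K$ such that $$(\forall k>K)\quad \|\nabla V(\mathbf{x}_k)\|\,\varphi'(V(\mathbf{x}_k)-V_\infty)\geq 1\quad\text{a.s.}$$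
   Context: A function $f:\mathcal{H}\to\mathbb{R}$ is coercive if $f(\mathbf{x})\to+\infty$ as $\|\mathbf{x}\|\to+\infty$. $|E|$ denotes the cardinality of a set $E$. The $\liminf$ of events $E_k$ is $\bigcup_{n}\bigcap_{k\geq n}E_k$. For $\zeta\in(0,+\infty]$, $\Phi_\zeta$ denotes the set of concave functions $\varphi:[0,\zeta)\to\mathbb{R}_+$ such that $\varphi(0)=0$, $\varphi$ is continuous at $0$, $\varphi\in C^1((0,\zeta))$ and $\varphi'(s)>0$ for every $s\in(0,\zeta)$. A differentiable function $f:\mathcal{H}\to\mathbb{R}$ satisfies the KL property at $\widetilde{\mathbf{x}}\in\mathcal{H}$ if there exist a neighbourhood $\mathcal{V}$ of $\widetilde{\mathbf{x}}$, $\zeta>0$ and $\varphi\in\Phi_\zeta$ such that $\|\nabla f(\mathbf{x})\|_{\mathcal{H}}\,\varphi'(f(\mathbf{x})-f(\widetilde{\mathbf{x}}))\geq 1$ for every $\mathbf{x}\in\mathcal{V}$ with $0<f(\mathbf{x})-f(\widetilde{\mathbf{x}})<\zeta$. It satisfies the KL property on $E\subset\mathcal{H}$ if it does so at every point of $E$. *)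

theory Defs
  imports "HOL-Probability.Probability"
begin

(* Only meaningful at points where f is differentiable. *)
definition gradient :: "('a::euclidean_space \<Rightarrow> real) \<Rightarrow> 'a \<Rightarrow> 'a" where
  "gradient f x = (THE D. GDERIV f x :> D)"

lemma gradient_eqI:
  assumes "GDERIV f x :> D"
  shows "gradient f x = D"
  unfolding gradient_def
proof (rule the_equality)
  fix E assume "GDERIV f x :> E"
  then have "(\<lambda>h. inner h E) = (\<lambda>h. inner h D)"
    using assms has_derivative_unique unfolding gderiv_def by blast
  then have "inner h (E - D) = 0" for h
    by (metis inner_diff_right right_minus_eq)
  then have "E - D = 0" using inner_eq_zero_iff by blast
  then show "E = D" by simp
qed (fact assms)

lemma gderiv_gradient:
  fixes f :: "'a::euclidean_space \<Rightarrow> real"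
  assumes "f differentiable (at x)"
  shows "GDERIV f x :> gradient f x"
proof -
  obtain f' where f': "(f has_derivative f') (at x)"
    using assms unfolding differentiable_def by blast
  then interpret linear f' by (rule has_derivative_linear)
  define D where "D = (\<Sum>b\<in>Basis. f' b *\<^sub>R b)"
  have "f' h = inner h D" for h
  proof -
    have "f' h = f' (\<Sum>b\<in>Basis. inner h b *\<^sub>R b)" by (simp add: euclidean_representation)
    also have "\<dots> = inner h D" by (simp add: D_def sum scale inner_sum_right mult.commute)
    finally show ?thesis .
  qed
  then have "GDERIV f x :> D" using f' unfolding gderiv_def by presburger
  then show ?thesis using gradient_eqI by metis
qed

definition continuously_differentiable :: "('a::euclidean_space \<Rightarrow> real) \<Rightarrow> bool" where
  "continuously_differentiable f \<longleftrightarrow>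
     (\<forall>x. f differentiable (at x)) \<and> continuous_on UNIV (gradient f)"

definition coercive :: "('a::real_normed_vector \<Rightarrow> real) \<Rightarrow> bool" where
  "coercive f \<longleftrightarrow> filterlim f at_top at_infinity"

(* Accumulation points of a sequence (not of its range): a constant sequence has one. *)
definition accumulation_points :: "(nat \<Rightarrow> 'a::metric_space) \<Rightarrow> 'a set" where
  "accumulation_points s = {y. \<exists>r. strict_mono r \<and> (s \<circ> r) \<longlonglongrightarrow> y}"

(* A function on [0,\<zeta>) is represented by a total function whose values outside
   [0,\<zeta>) are unconstrained. *)
definition Phi :: "ereal \<Rightarrow> (real \<Rightarrow> real) set" where
  "Phi \<zeta> = {\<phi>.
     concave_on {s. 0 \<le> s \<and> ereal s < \<zeta>} \<phi> \<and>
     (\<forall>s. 0 \<le> s \<and> ereal s < \<zeta> \<longrightarrow> 0 \<le> \<phi> s) \<and>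
     \<phi> 0 = 0 \<and>
     continuous (at 0 within {s. 0 \<le> s \<and> ereal s < \<zeta>}) \<phi> \<and>
     \<phi> C1_differentiable_on {s. 0 < s \<and> ereal s < \<zeta>} \<and>
     (\<forall>s. 0 < s \<and> ereal s < \<zeta> \<longrightarrow> 0 < deriv \<phi> s)}"

definition KL_at :: "('a::euclidean_space \<Rightarrow> real) \<Rightarrow> 'a \<Rightarrow> bool" where
  "KL_at f xt \<longleftrightarrow>
     (\<exists>N \<zeta> \<phi>. xt \<in> interior N \<and> (0::ereal) < \<zeta> \<and> \<phi> \<in> Phi \<zeta> \<and>
        (\<forall>x\<in>N. 0 < f x - f xt \<and> ereal (f x - f xt) < \<zeta> \<longrightarrow>
           norm (gradient f x) * deriv \<phi> (f x - f xt) \<ge> 1))"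

definition KL_on :: "('a::euclidean_space \<Rightarrow> real) \<Rightarrow> 'a set \<Rightarrow> bool" where
  "KL_on f E \<longleftrightarrow> (\<forall>xt\<in>E. KL_at f xt)"

definition liminf_events :: "(nat \<Rightarrow> 'w set) \<Rightarrow> 'w set" where
  "liminf_events E = (\<Union>n. \<Inter>k\<in>{n..}. E k)"

end

theory Submission
  imports Defs
begin

text \<open>
  Almost surely the limit of \<open>V (x k \<omega>)\<close> is the value of \<open>V\<close> at any accumulation point lying in
  \<open>\<Gamma>\<close>, so \<open>V_inf\<close> takes its values in the finite set \<open>V ` \<Gamma>\<close>. It therefore suffices to find one
  desingularizing function that works, for each such value \<open>v\<close>, on a whole slab
  \<open>v < V y < v + \<zeta>\<close> (lemma \<open>KL_uniform_on_finite_values\<close>): for large \<open>k\<close> the point \<open>x k \<omega>\<close> lies in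
  the slab above \<open>V_inf \<omega>\<close>, by convergence and because \<open>V (x k \<omega>)\<close> stays above its limit.

  By coercivity each level set \<open>V = v\<close> is compact, hence covered by finitely many of the
  neighbourhoods given by the KL property, and a thin enough slab stays inside this cover. There
  one has to merge finitely many desingularizing functions, each with its own domain
  \<open>[0,\<zeta>)\<close>. This is easy once all of them are bounded elements of \<open>Phi \<infinity>\<close>: their sum is
  another one, and its derivative dominates the derivatives of the summands.

  To pass from \<open>\<phi> \<in> Phi \<zeta>\<close> to a bounded element of \<open>Phi \<infinity>\<close>, fix \<open>0 < a < \<zeta>\<close> and take
  \<open>4 * \<phi> (h s)\<close> with \<open>h s = a * s / (a + s)\<close>. The map \<open>h\<close> is concave and squeezes \<open>[0,\<infinity>)\<close> into
  \<open>[0,a)\<close>, which makes the composition concave and bounded; since \<open>h s \<le> s\<close> and the slope of \<open>h\<close>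
  is at least \<open>1/4\<close> on \<open>[0,a]\<close>, its derivative is at least that of \<open>\<phi>\<close> near \<open>0\<close>.
\<close>

section \<open>Concave desingularizing functions\<close>

lemma Phi_infinity_iff:
  "\<psi> \<in> Phi \<infinity> \<longleftrightarrow> concave_on {0..} \<psi> \<and> (\<forall>s\<ge>0. 0 \<le> \<psi> s) \<and> \<psi> 0 = 0 \<and>
     continuous (at 0 within {0..}) \<psi> \<and> \<psi> C1_differentiable_on {0<..} \<and> (\<forall>s>0. 0 < deriv \<psi> s)"
proof -
  have "{s. 0 \<le> s \<and> ereal s < \<infinity>} = {0..}" "{s. 0 < s \<and> ereal s < \<infinity>} = {0<..}" by auto
  then show ?thesis by (simp add: Phi_def)
qed

lemma C1_differentiable_on_DERIV:
  fixes f :: "real \<Rightarrow> real"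
  assumes "f C1_differentiable_on S" "s \<in> S"
  shows "(f has_real_derivative deriv f s) (at s)"
  using assms unfolding C1_differentiable_on_eq
  by (meson DERIV_deriv_iff_real_differentiable)

lemma Phi_DERIV:
  assumes "\<phi> \<in> Phi \<zeta>" "0 < s" "ereal s < \<zeta>"
  shows "(\<phi> has_real_derivative deriv \<phi> s) (at s)"
  using assms by (intro C1_differentiable_on_DERIV[of _ "{s. 0 < s \<and> ereal s < \<zeta>}"]) (auto simp: Phi_def)

text \<open>
  Since \<open>t = 0\<close> is allowed, monotonicity on all of \<open>[0,\<zeta>)\<close> follows from this bound, although \<open>\<phi>\<close>
  need not be differentiable at \<open>0\<close>.
\<close>
lemma Phi_below_tangent:
  assumes "\<phi> \<in> Phi \<zeta>" "0 < s" "ereal s < \<zeta>" "0 \<le> t" "ereal t < \<zeta>"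
  shows "\<phi> t \<le> \<phi> s + deriv \<phi> s * (t - s)"
proof -
  (* Cutting the domain at a real b makes it a real interval whose interior the simplifier knows. *)
  have "ereal (max s t) < \<zeta>" using assms by (simp add: max_def)
  then obtain b where b: "max s t < b" "ereal b < \<zeta>"
    using ereal_dense2[of "ereal (max s t)" \<zeta>] by (metis less_ereal.simps(1))
  have "{0..<b} \<subseteq> {s. 0 \<le> s \<and> ereal s < \<zeta>}"
  proof
    fix u assume "u \<in> {0..<b}"
    then have "0 \<le> u" "ereal u < ereal b" by auto
    then show "u \<in> {s. 0 \<le> s \<and> ereal s < \<zeta>}" using less_trans[OF _ b(2)] by simp
  qed
  then have "concave_on {0..<b} \<phi>"
    using assms(1) unfolding Phi_def concave_on_def by (blast intro: convex_on_subset convex_real_interval)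
  then have cvx: "convex_on {0..<b} (\<lambda>s. - \<phi> s)" by (simp add: concave_on_def)
  have der: "((\<lambda>s. - \<phi> s) has_real_derivative - deriv \<phi> s) (at s within {0..<b})"
    using has_field_derivative_at_within[OF Phi_DERIV[OF assms(1-3)]] by (rule DERIV_minus)
  have "(- \<phi> t) - (- \<phi> s) \<ge> - deriv \<phi> s * (t - s)"
  proof (rule convex_on_imp_above_tangent[OF cvx _ _ _ der])
    show "connected {0..<b}" by simp
    show "s \<in> interior {0..<b}" using assms b by simp
    show "t \<in> {0..<b}" using assms b by simp
  qed
  then show ?thesis by simp
qed

lemma Phi_mono:
  assumes "\<phi> \<in> Phi \<zeta>" "0 \<le> s" "s \<le> t" "ereal t < \<zeta>"
  shows "\<phi> s \<le> \<phi> t"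
proof (cases "s = t")
  case False
  then have t: "0 < t" using assms by simp
  have s: "ereal s < \<zeta>" using le_less_trans[OF _ assms(4), of "ereal s"] assms(3) by simp
  have "0 < deriv \<phi> t" using assms t by (auto simp: Phi_def)
  then have "deriv \<phi> t * (s - t) \<le> 0" using assms by (simp add: mult_nonneg_nonpos)
  then show ?thesis using Phi_below_tangent[OF assms(1) t assms(4) assms(2) s] by simp
qed simp

lemma Phi_deriv_antimono:
  assumes "\<phi> \<in> Phi \<zeta>" "0 < s" "s \<le> t" "ereal t < \<zeta>"
  shows "deriv \<phi> t \<le> deriv \<phi> s"
proof (cases "s = t")
  case False
  have s: "ereal s < \<zeta>" using le_less_trans[OF _ assms(4), of "ereal s"] assms(3) by simp
  have "\<phi> t \<le> \<phi> s + deriv \<phi> s * (t - s)"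
    by (rule Phi_below_tangent[OF assms(1)]) (use assms s in simp_all)
  moreover have "\<phi> s \<le> \<phi> t + deriv \<phi> t * (s - t)"
    by (rule Phi_below_tangent[OF assms(1)]) (use assms s in simp_all)
  ultimately have "deriv \<phi> t * (t - s) \<le> deriv \<phi> s * (t - s)" by (simp add: algebra_simps)
  then show ?thesis using False assms by (simp add: mult_le_cancel_right)
qed simp

section \<open>Bounded desingularizing functions on the half-line\<close>

definition bounded_Phi :: "(real \<Rightarrow> real) set" where
  "bounded_Phi = {\<psi> \<in> Phi \<infinity>. bounded (\<psi> ` {0..})}"

lemma bounded_Phi_DERIV:
  assumes "\<psi> \<in> bounded_Phi" "0 < s"
  shows "(\<psi> has_real_derivative deriv \<psi> s) (at s)"
  using assms by (intro Phi_DERIV[of _ \<infinity>]) (auto simp: bounded_Phi_def)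

lemma bounded_Phi_deriv_pos:
  assumes "\<psi> \<in> bounded_Phi" "0 < s"
  shows "0 < deriv \<psi> s"
  using assms by (auto simp: bounded_Phi_def Phi_infinity_iff)

lemma bounded_Phi_add:
  assumes "\<psi> \<in> bounded_Phi" "\<theta> \<in> bounded_Phi"
  shows "(\<lambda>s. \<psi> s + \<theta> s) \<in> bounded_Phi"
    and "0 < s \<Longrightarrow> deriv (\<lambda>s. \<psi> s + \<theta> s) s = deriv \<psi> s + deriv \<theta> s"
proof -
  show der: "deriv (\<lambda>s. \<psi> s + \<theta> s) s = deriv \<psi> s + deriv \<theta> s" if "0 < s" for s
    using bounded_Phi_DERIV[OF assms(1) that] bounded_Phi_DERIV[OF assms(2) that]
    by (intro DERIV_imp_deriv DERIV_add)
  have "(\<lambda>s. \<psi> s + \<theta> s) \<in> Phi \<infinity>"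
    using assms der
    by (auto simp: Phi_infinity_iff bounded_Phi_def add_pos_pos
          intro!: concave_on_add continuous_intros C1_differentiable_on_add)
  moreover have "bounded ((\<lambda>s. \<psi> s + \<theta> s) ` {0..})"
    using assms by (auto simp: bounded_Phi_def intro!: bounded_plus_comp)
  ultimately show "(\<lambda>s. \<psi> s + \<theta> s) \<in> bounded_Phi" by (simp add: bounded_Phi_def)
qed

text \<open>
  The sum of the family dominates, because all the derivatives are positive.
\<close>
lemma bounded_Phi_dominating_finite:
  assumes "finite F" "F \<noteq> {}" "\<And>i. i \<in> F \<Longrightarrow> \<psi> i \<in> bounded_Phi"
  obtains \<theta> where "\<theta> \<in> bounded_Phi" "\<And>i s. i \<in> F \<Longrightarrow> 0 < s \<Longrightarrow> deriv (\<psi> i) s \<le> deriv \<theta> s"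
proof -
  have "\<exists>\<theta>\<in>bounded_Phi. \<forall>i\<in>F. \<forall>s>0. deriv (\<psi> i) s \<le> deriv \<theta> s"
    using assms
  proof (induction F rule: finite_ne_induct)
    case (singleton i)
    then show ?case by auto
  next
    case (insert j F)
    then obtain \<theta> where \<theta>: "\<theta> \<in> bounded_Phi" "\<forall>i\<in>F. \<forall>s>0. deriv (\<psi> i) s \<le> deriv \<theta> s"
      by auto
    have j: "\<psi> j \<in> bounded_Phi" using insert by simp
    have "deriv (\<psi> i) s \<le> deriv (\<lambda>s. \<psi> j s + \<theta> s) s" if "i \<in> insert j F" "0 < s" for i s
      using that \<theta>(2) bounded_Phi_add(2)[OF j \<theta>(1) that(2)]
        bounded_Phi_deriv_pos[OF j that(2)] bounded_Phi_deriv_pos[OF \<theta>(1) that(2)] by fastforce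
    then show ?case using bounded_Phi_add(1)[OF j \<theta>(1)] by blast
  qed
  then show ?thesis using that by blast
qed

text \<open>
  Instead of truncating \<open>\<phi>\<close> and gluing on a bounded tail, the half-line is compressed smoothly into
  the domain of \<open>\<phi>\<close>. The compression loses at most a factor \<open>4\<close> in slope on \<open>[0,a]\<close>, which the
  prefactor compensates.
\<close>
lemma Phi_dominated_by_bounded_Phi:
  assumes "\<phi> \<in> Phi \<zeta>" "0 < \<zeta>"
  obtains a \<psi> where "0 < a" "ereal a < \<zeta>" "\<psi> \<in> bounded_Phi"
    "\<And>s. 0 < s \<Longrightarrow> s < a \<Longrightarrow> deriv \<phi> s \<le> deriv \<psi> s"
proof -
  obtain a where a: "0 < a" "ereal a < \<zeta>" using ereal_dense2[of 0 \<zeta>] assms(2) by auto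
  define h where "h s = a * s / (a + s)" for s
  define \<psi> where "\<psi> s = 4 * \<phi> (h s)" for s
  have h0: "0 \<le> h s" "h s < a" "h s \<le> s" if "0 \<le> s" for s
    using that a by (auto simp: h_def divide_simps algebra_simps)
  have hpos: "0 < h s" if "0 < s" for s
    using that a by (auto simp: h_def)
  have h\<zeta>: "ereal (h s) < \<zeta>" if "0 \<le> s" for s
    using h0[OF that] less_trans[OF _ a(2), of "ereal (h s)"] by simp
  have h_DERIV: "(h has_real_derivative a\<^sup>2 / (a + s)\<^sup>2) (at s)" if "0 \<le> s" for s
    unfolding h_def using that a
    by (auto intro!: derivative_eq_intros simp: divide_simps power2_eq_square algebra_simps)
  have \<psi>_DERIV: "(\<psi> has_real_derivative 4 * (deriv \<phi> (h s) * (a\<^sup>2 / (a + s)\<^sup>2))) (at s)" if "0 < s" for s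
  proof -
    have "((\<lambda>s. \<phi> (h s)) has_real_derivative deriv \<phi> (h s) * (a\<^sup>2 / (a + s)\<^sup>2)) (at s)"
      by (rule DERIV_chain2[OF Phi_DERIV[OF assms(1)] h_DERIV]) (use that hpos h\<zeta> in auto)
    then show ?thesis unfolding \<psi>_def by (rule DERIV_cmult)
  qed
  have deriv_\<psi>: "deriv \<psi> s = 4 * (deriv \<phi> (h s) * (a\<^sup>2 / (a + s)\<^sup>2))" if "0 < s" for s
    using \<psi>_DERIV[OF that] by (rule DERIV_imp_deriv)
  have \<phi>'pos: "0 < deriv \<phi> (h s)" if "0 < s" for s
    using assms(1) hpos[OF that] h\<zeta>[of s] that by (auto simp: Phi_def)
  have h_concave: "u * h s + v * h t \<le> h (u * s + v * t)"
    if "0 \<le> s" "0 \<le> t" "0 \<le> u" "0 \<le> v" "u + v = 1" for s t u v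
  proof -
    (* h s = a - a^2 / (a + s), so concavity of h is convexity of the reciprocal. *)
    have "convex_on {0<..} (inverse :: real \<Rightarrow> real)" by (rule convex_on_inverse) auto
    then have "inverse (u * (a + s) + v * (a + t)) \<le> u * inverse (a + s) + v * inverse (a + t)"
      using that a unfolding convex_on_def by auto
    moreover have "u * (a + s) + v * (a + t) = a + (u * s + v * t)"
    proof -
      have "u * (a + s) + v * (a + t) = (u + v) * a + (u * s + v * t)" by (simp add: algebra_simps)
      then show ?thesis using that(5) by simp
    qed
    ultimately have inv: "inverse (a + (u * s + v * t)) \<le> u * inverse (a + s) + v * inverse (a + t)"
      by simp
    have h_eq: "h r = a - a\<^sup>2 * inverse (a + r)" if "0 \<le> r" for r
      using a that by (simp add: h_def divide_simps power2_eq_square algebra_simps)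
    have "u * h s + v * h t = (u + v) * a - a\<^sup>2 * (u * inverse (a + s) + v * inverse (a + t))"
      using that(1,2) by (simp add: h_eq algebra_simps)
    also have "\<dots> \<le> a - a\<^sup>2 * inverse (a + (u * s + v * t))"
      using mult_left_mono[OF inv, of "a\<^sup>2"] that(5) by simp
    also have "\<dots> = h (u * s + v * t)" using that by (simp add: h_eq)
    finally show ?thesis .
  qed
  have concave: "concave_on {0..} \<psi>"
    unfolding concave_on_iff
  proof (intro conjI ballI allI impI)
    fix s t u v :: real
    assume s: "s \<in> {0..}" and t: "t \<in> {0..}" and uv: "0 \<le> u" "0 \<le> v" "u + v = 1"
    have c: "concave_on {s. 0 \<le> s \<and> ereal s < \<zeta>} \<phi>" using assms(1) by (simp add: Phi_def)
    have "u * \<phi> (h s) + v * \<phi> (h t) \<le> \<phi> (u * h s + v * h t)"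
      using c s t uv h0 h\<zeta> unfolding concave_on_iff by simp
    also have "\<dots> \<le> \<phi> (h (u * s + v * t))"
      using s t uv h0 h\<zeta> by (intro Phi_mono[OF assms(1)] h_concave) auto
    finally show "u * \<psi> s + v * \<psi> t \<le> \<psi> (u *\<^sub>R s + v *\<^sub>R t)" by (simp add: \<psi>_def)
  qed auto
  have cont0: "continuous (at 0 within {0..}) \<psi>"
  proof -
    have "continuous (at (h 0) within {s. 0 \<le> s \<and> ereal s < \<zeta>}) \<phi>"
      using assms(1) by (simp add: Phi_def h_def)
    then have "continuous (at (h 0) within h ` {0..}) \<phi>"
      by (rule continuous_within_subset) (use h0 h\<zeta> in auto)
    moreover have "continuous (at 0 within {0..}) h"
      using h_DERIV[of 0] by (auto intro: DERIV_isCont continuous_at_imp_continuous_at_within)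
    ultimately have "continuous (at 0 within {0..}) (\<lambda>s. \<phi> (h s))"
      using continuous_within_compose2 by blast
    then show ?thesis unfolding \<psi>_def by (intro continuous_intros)
  qed
  have C1: "\<psi> C1_differentiable_on {0<..}"
    unfolding C1_differentiable_on_def
  proof (intro exI conjI ballI)
    show "(\<psi> has_vector_derivative 4 * (deriv \<phi> (h s) * (a\<^sup>2 / (a + s)\<^sup>2))) (at s)" if "s \<in> {0<..}" for s
      using \<psi>_DERIV that by (simp add: has_real_derivative_iff_has_vector_derivative)
    have "continuous_on {s. 0 < s \<and> ereal s < \<zeta>} (\<lambda>s. vector_derivative \<phi> (at s))"
      using assms(1) by (simp add: Phi_def C1_differentiable_on_eq)
    then have "continuous_on {s. 0 < s \<and> ereal s < \<zeta>} (deriv \<phi>)"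
    proof (rule continuous_on_eq)
      fix s assume "s \<in> {s. 0 < s \<and> ereal s < \<zeta>}"
      then have "(\<phi> has_real_derivative deriv \<phi> s) (at s)"
        by (intro Phi_DERIV[OF assms(1)]) auto
      then show "vector_derivative \<phi> (at s) = deriv \<phi> s"
        by (intro vector_derivative_at) (simp add: has_real_derivative_iff_has_vector_derivative)
    qed
    moreover have "continuous_on {0<..} h"
      using h_DERIV by (meson DERIV_isCont continuous_at_imp_continuous_on greaterThan_iff less_imp_le)
    moreover have "h ` {0<..} \<subseteq> {s. 0 < s \<and> ereal s < \<zeta>}"
      using hpos h\<zeta> by auto
    ultimately have "continuous_on {0<..} (\<lambda>s. deriv \<phi> (h s))"
      by (rule continuous_on_compose2)
    then show "continuous_on {0<..} (\<lambda>s. 4 * (deriv \<phi> (h s) * (a\<^sup>2 / (a + s)\<^sup>2)))"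
      using a by (auto intro!: continuous_intros)
  qed
  have nonneg: "0 \<le> \<psi> s" if "0 \<le> s" for s
    using assms(1) h0[OF that] h\<zeta>[OF that] by (auto simp: \<psi>_def Phi_def)
  have "0 < deriv \<psi> s" if "0 < s" for s
    using \<phi>'pos[OF that] that a by (simp add: deriv_\<psi>)
  moreover have "\<psi> 0 = 0" using assms(1) by (simp add: \<psi>_def h_def Phi_def)
  ultimately have "\<psi> \<in> Phi \<infinity>"
    using concave cont0 C1 nonneg by (simp add: Phi_infinity_iff)
  moreover have "bounded (\<psi> ` {0..})"
    unfolding bounded_iff
  proof (intro exI ballI)
    fix y assume "y \<in> \<psi> ` {0..}"
    then obtain s where s: "0 \<le> s" "y = \<psi> s" by auto
    have "\<phi> (h s) \<le> \<phi> a"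
      using h0[OF s(1)] a by (intro Phi_mono[OF assms(1)]) auto
    then show "norm y \<le> 4 * \<phi> a" using nonneg[OF s(1)] s(2) by (simp add: \<psi>_def)
  qed
  ultimately have "\<psi> \<in> bounded_Phi" by (simp add: bounded_Phi_def)
  moreover have "deriv \<phi> s \<le> deriv \<psi> s" if s: "0 < s" "s < a" for s
  proof -
    have s\<zeta>: "ereal s < \<zeta>" using s less_trans[OF _ a(2), of "ereal s"] by simp
    (* The slope of h is at least 1/4 here, since a + s \<le> 2 * a. *)
    have "1 \<le> 4 * (a\<^sup>2 / (a + s)\<^sup>2)"
    proof -
      have "(a + s)\<^sup>2 \<le> (2 * a)\<^sup>2" using s by (intro power_mono) auto
      moreover have "0 < (a + s)\<^sup>2" using s by simp
      ultimately show ?thesis by (simp add: power_mult_distrib)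
    qed
    then have "deriv \<phi> (h s) * 1 \<le> deriv \<phi> (h s) * (4 * (a\<^sup>2 / (a + s)\<^sup>2))"
      using \<phi>'pos[OF s(1)] by (intro mult_left_mono) auto
    moreover have "deriv \<phi> s \<le> deriv \<phi> (h s)"
      using hpos[OF s(1)] h0[of s] s s\<zeta> by (intro Phi_deriv_antimono[OF assms(1)]) auto
    ultimately show ?thesis by (simp add: deriv_\<psi>[OF s(1)] ac_simps)
  qed
  ultimately show ?thesis using that a by blast
qed

section \<open>Uniform Kurdyka-Lojasiewicz inequality\<close>

lemma KL_at_bounded_Phi:
  assumes "KL_at V p"
  obtains U a \<psi> where "open U" "p \<in> U" "0 < a" "\<psi> \<in> bounded_Phi"
    "\<And>y. y \<in> U \<Longrightarrow> V p < V y \<Longrightarrow> V y < V p + a \<Longrightarrow>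
       1 \<le> norm (gradient V y) * deriv \<psi> (V y - V p)"
proof -
  obtain N \<zeta> \<phi> where N: "p \<in> interior N" and \<zeta>: "(0::ereal) < \<zeta>" and \<phi>: "\<phi> \<in> Phi \<zeta>"
    and KL: "\<And>y. y \<in> N \<Longrightarrow> 0 < V y - V p \<Longrightarrow> ereal (V y - V p) < \<zeta> \<Longrightarrow>
           1 \<le> norm (gradient V y) * deriv \<phi> (V y - V p)"
    using assms unfolding KL_at_def by blast
  obtain a \<psi> where a: "0 < a" "ereal a < \<zeta>" and \<psi>: "\<psi> \<in> bounded_Phi"
    and dom: "\<And>s. 0 < s \<Longrightarrow> s < a \<Longrightarrow> deriv \<phi> s \<le> deriv \<psi> s"
    using Phi_dominated_by_bounded_Phi[OF \<phi> \<zeta>] by blast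
  have "1 \<le> norm (gradient V y) * deriv \<psi> (V y - V p)"
    if y: "y \<in> interior N" "V p < V y" "V y < V p + a" for y
  proof -
    have "ereal (V y - V p) < ereal a" using y by simp
    then have "ereal (V y - V p) < \<zeta>" using a(2) by (rule less_trans)
    then have "1 \<le> norm (gradient V y) * deriv \<phi> (V y - V p)"
      using y interior_subset[of N] by (intro KL) auto
    also have "\<dots> \<le> norm (gradient V y) * deriv \<psi> (V y - V p)"
      using y by (intro mult_left_mono dom) auto
    finally show ?thesis .
  qed
  then show ?thesis using that[of "interior N" a \<psi>] N a \<psi> by blast
qed

lemma coercive_sublevel_compact:
  fixes V :: "'a::euclidean_space \<Rightarrow> real"
  assumes "coercive V" "continuous_on UNIV V"
  shows "compact {y. V y \<le> c}"
proof -
  have "eventually (\<lambda>y. c < V y) at_infinity"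
    using assms(1) unfolding coercive_def filterlim_at_top_dense by blast
  then obtain b where b: "\<And>y. b \<le> norm y \<Longrightarrow> c < V y" unfolding eventually_at_infinity by blast
  then have "bounded {y. V y \<le> c}"
    by (intro boundedI[of _ b]) (metis linorder_not_less mem_Collect_eq nle_le)
  moreover have "closed {y. V y \<le> c}"
    using assms(2) by (intro closed_Collect_le) auto
  ultimately show ?thesis by (simp add: compact_eq_bounded_closed)
qed

text \<open>
  Finitely many KL neighbourhoods cover the compact level set. If they miss part of the compact
  region \<open>v \<le> V \<le> v + 1\<close>, then \<open>V\<close> attains there a minimum exceeding \<open>v\<close>. A slab thinner than this
  gap lies in the cover, so no distance to the level set enters the conclusion.
\<close>
lemma KL_uniform_on_level:
  fixes V :: "'a::euclidean_space \<Rightarrow> real"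
  assumes "coercive V" "continuous_on UNIV V" "KL_on V {y. V y = v}" "v \<in> range V"
  obtains \<zeta> \<psi> where "0 < \<zeta>" "\<psi> \<in> bounded_Phi"
    "\<And>y. v < V y \<Longrightarrow> V y < v + \<zeta> \<Longrightarrow> 1 \<le> norm (gradient V y) * deriv \<psi> (V y - v)"
proof -
  define L where "L = {y. V y = v}"
  have "\<forall>p\<in>L. \<exists>U a \<psi>. open U \<and> p \<in> U \<and> 0 < a \<and> \<psi> \<in> bounded_Phi \<and>
    (\<forall>y\<in>U. v < V y \<longrightarrow> V y < v + a \<longrightarrow> 1 \<le> norm (gradient V y) * deriv \<psi> (V y - v))"
  proof
    fix p assume "p \<in> L"
    then have p: "KL_at V p" "V p = v" using assms(3) by (auto simp: L_def KL_on_def)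
    show "\<exists>U a \<psi>. open U \<and> p \<in> U \<and> 0 < a \<and> \<psi> \<in> bounded_Phi \<and>
      (\<forall>y\<in>U. v < V y \<longrightarrow> V y < v + a \<longrightarrow> 1 \<le> norm (gradient V y) * deriv \<psi> (V y - v))"
      using KL_at_bounded_Phi[OF p(1)] unfolding p(2) by metis
  qed
  then obtain U a \<psi> where U: "\<And>p. p \<in> L \<Longrightarrow> open (U p) \<and> p \<in> U p"
    and a: "\<And>p. p \<in> L \<Longrightarrow> 0 < (a p :: real)" and \<psi>: "\<And>p. p \<in> L \<Longrightarrow> \<psi> p \<in> bounded_Phi"
    and KL: "\<And>p y. p \<in> L \<Longrightarrow> y \<in> U p \<Longrightarrow> v < V y \<Longrightarrow> V y < v + a p \<Longrightarrow>
           1 \<le> norm (gradient V y) * deriv (\<psi> p) (V y - v)"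
    by metis
  have comp: "compact {y. V y \<le> c}" for c
    using coercive_sublevel_compact[OF assms(1,2)] .
  have "closed L" unfolding L_def using assms(2) by (intro closed_Collect_eq) auto
  then have "compact ({y. V y \<le> v} \<inter> L)" using comp by (intro compact_Int_closed)
  moreover have "{y. V y \<le> v} \<inter> L = L" by (auto simp: L_def)
  ultimately have "compact L" by simp
  then obtain F where F: "F \<subseteq> L" "finite F" "L \<subseteq> (\<Union>p\<in>F. U p)"
    using compactE_image[of L L U] U by blast
  have "L \<noteq> {}" using assms(4) by (auto simp: L_def)
  then have "F \<noteq> {}" using F(3) by auto
  obtain \<theta> where \<theta>: "\<theta> \<in> bounded_Phi"
    and dom: "\<And>p s. p \<in> F \<Longrightarrow> 0 < s \<Longrightarrow> deriv (\<psi> p) s \<le> deriv \<theta> s"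
    using bounded_Phi_dominating_finite[OF F(2) \<open>F \<noteq> {}\<close>, of \<psi>] \<psi> F(1) by blast
  define C where "C = {y. V y \<le> v + 1} \<inter> ({y. v \<le> V y} - (\<Union>p\<in>F. U p))"
  have "closed {y. v \<le> V y}" using assms(2) by (intro closed_Collect_le) auto
  moreover have "open (\<Union>p\<in>F. U p)" using U F(1) by auto
  ultimately have "compact C" unfolding C_def using comp by (intro compact_Int_closed closed_Diff)
  have C_above: "v < V y" if "y \<in> C" for y
  proof -
    have "y \<notin> L" "v \<le> V y" using that F(3) by (auto simp: C_def)
    then show ?thesis by (simp add: L_def)
  qed
  obtain m where m: "v < m" "\<And>y. y \<in> C \<Longrightarrow> m \<le> V y"
  proof (cases "C = {}")
    case True
    then show ?thesis using that[of "v + 1"] by simp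
  next
    case False
    obtain z where "z \<in> C" "\<And>y. y \<in> C \<Longrightarrow> V z \<le> V y"
      using continuous_attains_inf[OF \<open>compact C\<close> False, of V] assms(2) continuous_on_subset by blast
    then show ?thesis using that[of "V z"] C_above by blast
  qed
  define \<zeta> where "\<zeta> = min (min 1 (m - v)) (Min (a ` F))"
  have "0 < Min (a ` F)" using F a \<open>F \<noteq> {}\<close> by (subst Min_gr_iff) auto
  then have "0 < \<zeta>" using m(1) by (simp add: \<zeta>_def)
  moreover have "1 \<le> norm (gradient V y) * deriv \<theta> (V y - v)" if y: "v < V y" "V y < v + \<zeta>" for y
  proof -
    have "y \<notin> C" using m(2) y(2) by (fastforce simp: \<zeta>_def)
    then obtain p where p: "p \<in> F" "y \<in> U p" using y by (auto simp: C_def \<zeta>_def)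
    have "\<zeta> \<le> a p" using p(1) F(2) unfolding \<zeta>_def by (intro min.coboundedI2) auto
    then have "1 \<le> norm (gradient V y) * deriv (\<psi> p) (V y - v)"
      using p y F(1) by (intro KL) auto
    also have "\<dots> \<le> norm (gradient V y) * deriv \<theta> (V y - v)"
      using y p by (intro mult_left_mono dom) auto
    finally show ?thesis .
  qed
  ultimately show ?thesis using that \<theta> by blast
qed

lemma KL_uniform_on_finite_values:
  fixes V :: "'a::euclidean_space \<Rightarrow> real"
  assumes "coercive V" "continuous_on UNIV V" "KL_on V {y. V y \<in> W}"
    and W: "finite W" "W \<noteq> {}" "W \<subseteq> range V"
  obtains \<zeta> \<psi> where "0 < \<zeta>" "\<psi> \<in> bounded_Phi"
    "\<And>v y. v \<in> W \<Longrightarrow> v < V y \<Longrightarrow> V y < v + \<zeta> \<Longrightarrow> 1 \<le> norm (gradient V y) * deriv \<psi> (V y - v)"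
proof -
  have "\<forall>v\<in>W. \<exists>\<zeta> \<psi>. 0 < \<zeta> \<and> \<psi> \<in> bounded_Phi \<and>
    (\<forall>y. v < V y \<longrightarrow> V y < v + \<zeta> \<longrightarrow> 1 \<le> norm (gradient V y) * deriv \<psi> (V y - v))"
  proof
    fix v assume v: "v \<in> W"
    then have "KL_on V {y. V y = v}" "v \<in> range V" using assms(3) W(3) by (auto simp: KL_on_def)
    then show "\<exists>\<zeta> \<psi>. 0 < \<zeta> \<and> \<psi> \<in> bounded_Phi \<and>
      (\<forall>y. v < V y \<longrightarrow> V y < v + \<zeta> \<longrightarrow> 1 \<le> norm (gradient V y) * deriv \<psi> (V y - v))"
      using KL_uniform_on_level[OF assms(1,2)] by metis
  qed
  then obtain \<zeta> \<psi> where \<zeta>: "\<And>v. v \<in> W \<Longrightarrow> 0 < (\<zeta> v :: real)" and \<psi>: "\<And>v. v \<in> W \<Longrightarrow> \<psi> v \<in> bounded_Phi"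
    and KL: "\<And>v y. v \<in> W \<Longrightarrow> v < V y \<Longrightarrow> V y < v + \<zeta> v \<Longrightarrow>
           1 \<le> norm (gradient V y) * deriv (\<psi> v) (V y - v)"
    by metis
  obtain \<theta> where \<theta>: "\<theta> \<in> bounded_Phi"
    and dom: "\<And>v s. v \<in> W \<Longrightarrow> 0 < s \<Longrightarrow> deriv (\<psi> v) s \<le> deriv \<theta> s"
    using bounded_Phi_dominating_finite[OF W(1,2), of \<psi>] \<psi> by blast
  have "1 \<le> norm (gradient V y) * deriv \<theta> (V y - v)"
    if v: "v \<in> W" and y: "v < V y" "V y < v + Min (\<zeta> ` W)" for v y
  proof -
    have "Min (\<zeta> ` W) \<le> \<zeta> v" using v W(1) by auto
    then have "1 \<le> norm (gradient V y) * deriv (\<psi> v) (V y - v)"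
      using v y by (intro KL) auto
    also have "\<dots> \<le> norm (gradient V y) * deriv \<theta> (V y - v)"
      using v y by (intro mult_left_mono dom) auto
    finally show ?thesis .
  qed
  moreover have "0 < Min (\<zeta> ` W)" using W \<zeta> by (subst Min_gr_iff) auto
  ultimately show ?thesis using that \<theta> by blast
qed

section \<open>Limits along the process\<close>

lemma limit_value_at_accumulation_point:
  fixes V :: "'a::metric_space \<Rightarrow> real"
  assumes "continuous_on UNIV V" "y \<in> accumulation_points s" "(\<lambda>k. ereal (V (s k))) \<longlonglongrightarrow> l"
  shows "l = ereal (V y)"
proof -
  obtain r where r: "strict_mono r" "(s \<circ> r) \<longlonglongrightarrow> y"
    using assms(2) by (auto simp: accumulation_points_def)
  have "(\<lambda>k. V ((s \<circ> r) k)) \<longlonglongrightarrow> V y"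
    using assms(1) r(2) by (intro isCont_tendsto_compose[of y V]) (auto simp: continuous_on_eq_continuous_at o_def)
  then have "(\<lambda>k. ereal (V (s (r k)))) \<longlonglongrightarrow> ereal (V y)" by (simp add: o_def)
  moreover have "(\<lambda>k. ereal (V (s (r k)))) \<longlonglongrightarrow> l"
    using LIMSEQ_subseq_LIMSEQ[OF assms(3) r(1)] by (simp add: o_def)
  ultimately show ?thesis using LIMSEQ_unique by blast
qed

text \<open>
  The random time is the first one after which the events hold for good. Taking its successor keeps
  it positive, and the value \<open>\<infinity>\<close> on the null set of failure makes the last property hold everywhere.
\<close>
lemma measurable_eventual_time:
  fixes P :: "nat \<Rightarrow> 'w \<Rightarrow> bool"
  assumes [measurable]: "\<And>k. Measurable.pred M (P k)"
    and ev: "AE \<omega> in M. eventually (\<lambda>k. P k \<omega>) sequentially"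
  obtains K :: "'w \<Rightarrow> enat" where "K \<in> measurable M (count_space UNIV)" "\<And>\<omega>. 0 < K \<omega>"
    "AE \<omega> in M. K \<omega> < \<infinity>" "\<And>\<omega> k. K \<omega> < enat k \<Longrightarrow> P k \<omega>"
proof -
  define Q where "Q n \<omega> \<longleftrightarrow> (\<forall>k>n. P k \<omega>)" for n \<omega>
  define K :: "'w \<Rightarrow> enat" where
    "K \<omega> = (if \<exists>n. Q n \<omega> then enat (Suc (LEAST n. Q n \<omega>)) else \<infinity>)" for \<omega>
  have [measurable]: "Measurable.pred M (Q n)" for n unfolding Q_def by measurable
  have "K \<in> measurable M (count_space UNIV)" unfolding K_def by measurable
  moreover have "0 < K \<omega>" for \<omega> by (simp add: K_def zero_enat_def)
  moreover have "AE \<omega> in M. K \<omega> < \<infinity>"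
    using ev
  proof eventually_elim
    case (elim \<omega>)
    then have "\<exists>n. Q n \<omega>" unfolding Q_def eventually_sequentially by (meson less_imp_le)
    then show ?case by (simp add: K_def)
  qed
  moreover have "P k \<omega>" if "K \<omega> < enat k" for \<omega> k
  proof -
    have ex: "\<exists>n. Q n \<omega>" using that by (auto simp: K_def split: if_splits)
    then have "Q (LEAST n. Q n \<omega>) \<omega>" by (rule LeastI_ex)
    moreover have "(LEAST n. Q n \<omega>) < k" using that ex by (simp add: K_def)
    ultimately show ?thesis unfolding Q_def by blast
  qed
  ultimately show ?thesis by (rule that)
qed

theorem proposition3p7:
  fixes M :: "'w measure"
    and x :: "nat \<Rightarrow> 'w \<Rightarrow> 'a::euclidean_space"
    and V :: "'a \<Rightarrow> real"
    and \<Gamma> :: "'a set"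
    and V_inf :: "'w \<Rightarrow> ereal"
  assumes "prob_space M"
    and "\<And>k. x k \<in> borel_measurable M"
    and "coercive V" and "continuously_differentiable V"
    and "V_inf \<in> borel_measurable M"
    and "AE \<omega> in M. (\<lambda>k. ereal (V (x k \<omega>))) \<longlonglongrightarrow> V_inf \<omega>"
    and "AE \<omega> in M. V_inf \<omega> < \<infinity>"
    and "\<Gamma> \<noteq> {}" and "finite (V ` \<Gamma>)"
    and "AE \<omega> in M. \<Gamma> \<inter> accumulation_points (\<lambda>k. x k \<omega>) \<noteq> {}"
    and "KL_on V UNIV"
    and "\<exists>(I::nat) C. 0 < I \<and> \<Gamma> = (\<Union>i\<in>{1..I}. C i) \<and>
           (\<forall>i\<in>{1..I}. compact (C i) \<and> V constant_on (C i))"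
    and "measure M (liminf_events (\<lambda>k. {\<omega> \<in> space M. ereal (V (x k \<omega>)) > V_inf \<omega>})) = 1"
  shows "\<exists>\<phi> \<in> Phi \<infinity>. bounded (\<phi> ` {0..}) \<and>
           (\<exists>K :: 'w \<Rightarrow> enat.
              K \<in> measurable M (count_space UNIV) \<and>
              (\<forall>\<omega>\<in>space M. 0 < K \<omega>) \<and>
              (AE \<omega> in M. K \<omega> < \<infinity>) \<and>
              (AE \<omega> in M. \<forall>k. K \<omega> < enat k \<longrightarrow>
                 0 < V (x k \<omega>) - real_of_ereal (V_inf \<omega>) \<and>
                 norm (gradient V (x k \<omega>)) * deriv \<phi> (V (x k \<omega>) - real_of_ereal (V_inf \<omega>)) \<ge> 1))"
proof -
  have cont: "continuous_on UNIV V"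
  proof -
    have "isCont V y" for y
      using assms(4) by (intro differentiable_imp_continuous_within) (simp add: continuously_differentiable_def)
    then show ?thesis by (simp add: continuous_at_imp_continuous_on)
  qed
  have "KL_on V {y. V y \<in> V ` \<Gamma>}" "V ` \<Gamma> \<noteq> {}" "V ` \<Gamma> \<subseteq> range V"
    using assms(8,11) by (auto simp: KL_on_def)
  then obtain \<zeta> \<psi> where "0 < \<zeta>" and \<psi>: "\<psi> \<in> bounded_Phi"
    and KL: "\<And>v y. v \<in> V ` \<Gamma> \<Longrightarrow> v < V y \<Longrightarrow> V y < v + \<zeta> \<Longrightarrow>
           1 \<le> norm (gradient V y) * deriv \<psi> (V y - v)"
    using KL_uniform_on_finite_values[OF assms(3) cont _ assms(9)] by blast
  (* The slab condition implies the KL inequality but does not mention gradients, so its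
     measurability is immediate. *)
  define near where
    "near k \<omega> \<longleftrightarrow> V_inf \<omega> < ereal (V (x k \<omega>)) \<and> ereal (V (x k \<omega>)) < V_inf \<omega> + ereal \<zeta>" for k \<omega>
  note [measurable] = assms(2,5) borel_measurable_continuous_onI[OF cont]
  have near_measurable: "Measurable.pred M (near k)" for k unfolding near_def by measurable
  have V_inf_value: "AE \<omega> in M. \<exists>v\<in>V ` \<Gamma>. V_inf \<omega> = ereal v"
    using assms(6,10)
  proof eventually_elim
    case (elim \<omega>)
    then show ?case using limit_value_at_accumulation_point[OF cont _ elim(1)] by blast
  qed
  have "AE \<omega> in M. \<omega> \<in> liminf_events (\<lambda>k. {\<omega> \<in> space M. ereal (V (x k \<omega>)) > V_inf \<omega>})"
    using prob_space.AE_prob_1[OF assms(1) assms(13)] .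
  then have "AE \<omega> in M. eventually (\<lambda>k. near k \<omega>) sequentially"
    using assms(6) V_inf_value
  proof eventually_elim
    case (elim \<omega>)
    have "eventually (\<lambda>k. V_inf \<omega> < ereal (V (x k \<omega>))) sequentially"
      using elim(1) by (auto simp: liminf_events_def eventually_sequentially)
    moreover have "V_inf \<omega> < V_inf \<omega> + ereal \<zeta>" using elim(3) \<open>0 < \<zeta>\<close> by auto
    then have "eventually (\<lambda>k. ereal (V (x k \<omega>)) < V_inf \<omega> + ereal \<zeta>) sequentially"
      using order_tendstoD(2)[OF elim(2)] by blast
    ultimately show ?case unfolding near_def by (rule eventually_conj)
  qed
  then obtain K :: "'w \<Rightarrow> enat" where K: "K \<in> measurable M (count_space UNIV)" "\<And>\<omega>. 0 < K \<omega>"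
    "AE \<omega> in M. K \<omega> < \<infinity>" and K_near: "\<And>\<omega> k. K \<omega> < enat k \<Longrightarrow> near k \<omega>"
    using measurable_eventual_time[of near M] near_measurable by blast
  have "AE \<omega> in M. \<forall>k. K \<omega> < enat k \<longrightarrow>
                 0 < V (x k \<omega>) - real_of_ereal (V_inf \<omega>) \<and>
                 norm (gradient V (x k \<omega>)) * deriv \<psi> (V (x k \<omega>) - real_of_ereal (V_inf \<omega>)) \<ge> 1"
    using V_inf_value
  proof eventually_elim
    case (elim \<omega>)
    then obtain v where v: "v \<in> V ` \<Gamma>" "V_inf \<omega> = ereal v" by blast
    show ?case
    proof (intro allI impI)
      fix k assume "K \<omega> < enat k"
      then have "near k \<omega>" by (rule K_near)
      then have "v < V (x k \<omega>)" "V (x k \<omega>) < v + \<zeta>" by (auto simp: near_def v(2))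
      then show "0 < V (x k \<omega>) - real_of_ereal (V_inf \<omega>) \<and>
          norm (gradient V (x k \<omega>)) * deriv \<psi> (V (x k \<omega>) - real_of_ereal (V_inf \<omega>)) \<ge> 1"
        using KL[OF v(1)] v(2) by simp
    qed
  qed
  then show ?thesis using K \<psi> unfolding bounded_Phi_def by blast
qed

end
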